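(* Let $\Omega\subseteq\mathbb{R}^n$ be open, let $\Phi:\Omega\times\mathbb{R}\times\mathbb{R}^n\to\mathbb{R}$ be jointly continuous, and consider the equation $$\Phi(x,u(x),Du(x))=0,\quad x\in\Omega. \qquad (E)$$ Assume that there exist Hausdorff continuous functions $u_1=[\underline{u}_1,\overline{u}_1]$ and $u_2=[\underline{u}_2,\overline{u}_2]$ on $\Omega$ such that $\overline{u}_1$ is a viscosity subsolution of (E), $\underline{u}_2$ is a viscosity supersolution of (E), and $u_1\leq u_2$. Then there exists a Hausdorff continuous viscosity solution $u$ of (E) satisfying $$u_1\leq u\leq u_2.$$
   Context: $USC(\Omega)$ and $LSC(\Omega)$ denote the sets of upper, respectively lower, semi-continuous functions $\Omega\to\mathbb{R}$. Viscosity sub- and supersolutions: $v\in USC(\Omega)$ is a (viscosity) subsolution of (E) if for every $\varphi\in C^1(\Omega)$ we have $\Phi(x_0,v(x_0),D\varphi(x_0))\leq 0$ at any local maximum point $x_0$ of $v-\varphi$. $v\in LSC(\Omega)$ is a (viscosity) supersolution of (E) if for every $\varphi\in C^1(\Omega)$ we have $\Phi(x_0,v(x_0),D\varphi(x_0))\geq 0$ at any local minimum point $x_0$ of $v-\varphi$. Interval valued functions: $\mathbb{A}(\Omega)$ is the set of functions $f$ on $\Omega$ whose values are closed finite real intervals; write $f=[\underline{f},\overline{f}]$, i.e. $f(x)=[\underline{f}(x),\overline{f}(x)]$ with real-valued $\underline{f}\leq\overline{f}$. A real $a$ is identified with the interval $[a,a]$, so real functions belong to $\mathbb{A}(\Omega)$.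 For $f\in\mathbb{A}(\Omega)$, with $B_\delta(x)$ the open $\delta$-neighborhood of $x$ in $\Omega$, put $S(f)(x)=\inf_{\delta>0}\sup\{z\in f(y):y\in B_\delta(x)\}$, $I(f)(x)=\sup_{\delta>0}\inf\{z\in f(y):y\in B_\delta(x)\}$, and $F(f)(x)=[I(f)(x),S(f)(x)]$ (the graph completion of $f$). $f$ is S-continuous if $F(f)=f$; $\mathbb{F}(\Omega)$ is the set of all S-continuous functions on $\Omega$. H-continuity: $f\in\mathbb{A}(\Omega)$ is Hausdorff continuous (H-continuous) if for every $g\in\mathbb{A}(\Omega)$ with $g(x)\subseteq f(x)$ for all $x\in\Omega$, we have $F(g)(x)=f(x)$ for all $x\in\Omega$. Every H-continuous function is S-continuous (take $g=f$). Order: for H-continuous $f=[\underline{f},\overline{f}]$ and $g=[\underline{g},\overline{g}]$, $f\leq g$ means $\underline{f}(x)\leq\underline{g}(x)$ and $\overline{f}(x)\leq\overline{g}(x)$ for all $x\in\Omega$. Interval valued viscosity solution: $u=[\underline{u},\overline{u}]\in\mathbb{F}(\Omega)$ is a viscosity solution of (E) if $\underline{u}$ is a supersolution of (E) and $\overline{u}$ is a subsolution of (E). A Hausdorff continuous viscosity solution is an H-continuous function that is a viscosity solution in this sense. *)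

theory Defs
  imports "HOL-Analysis.Analysis" "HOL-Library.Interval"
begin

text \<open>
  Functions on an open set \<open>\<Omega>\<close> are total functions of which only the values on \<open>\<Omega>\<close> matter;
  all notions below take \<open>\<Omega>\<close> as a parameter. Interval valued functions have type
  \<open>_ \<Rightarrow> real interval\<close>, so that each value is a nonempty compact real interval. The library's
  order on \<open>interval\<close> is inclusion, not the componentwise order, and is avoided here.
\<close>

definition usc_on :: "'a::topological_space set \<Rightarrow> ('a \<Rightarrow> real) \<Rightarrow> bool" where
  "usc_on \<Omega> v \<longleftrightarrow> (\<forall>x\<in>\<Omega>. \<forall>c>v x. \<forall>\<^sub>F y in at x within \<Omega>. v y < c)"

definition lsc_on :: "'a::topological_space set \<Rightarrow> ('a \<Rightarrow> real) \<Rightarrow> bool" where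
  "lsc_on \<Omega> v \<longleftrightarrow> (\<forall>x\<in>\<Omega>. \<forall>c<v x. \<forall>\<^sub>F y in at x within \<Omega>. c < v y)"

definition local_max_at :: "'a::metric_space set \<Rightarrow> ('a \<Rightarrow> real) \<Rightarrow> 'a \<Rightarrow> bool" where
  "local_max_at \<Omega> w x \<longleftrightarrow> x \<in> \<Omega> \<and> (\<exists>\<delta>>0. \<forall>y\<in>ball x \<delta> \<inter> \<Omega>. w y \<le> w x)"

definition local_min_at :: "'a::metric_space set \<Rightarrow> ('a \<Rightarrow> real) \<Rightarrow> 'a \<Rightarrow> bool" where
  "local_min_at \<Omega> w x \<longleftrightarrow> x \<in> \<Omega> \<and> (\<exists>\<delta>>0. \<forall>y\<in>ball x \<delta> \<inter> \<Omega>. w x \<le> w y)"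

text \<open>\<open>\<phi>\<close> is of class \<open>C\<^sup>1\<close> on the open set \<open>\<Omega>\<close>, with gradient \<open>D\<phi>\<close> there.\<close>

definition C1_with_gradient ::
  "'a::real_inner set \<Rightarrow> ('a \<Rightarrow> real) \<Rightarrow> ('a \<Rightarrow> 'a) \<Rightarrow> bool" where
  "C1_with_gradient \<Omega> \<phi> D\<phi> \<longleftrightarrow> (\<forall>x\<in>\<Omega>. GDERIV \<phi> x :> D\<phi> x) \<and> continuous_on \<Omega> D\<phi>"

definition viscosity_subsolution ::
  "'a::real_inner set \<Rightarrow> ('a \<Rightarrow> real \<Rightarrow> 'a \<Rightarrow> real) \<Rightarrow> ('a \<Rightarrow> real) \<Rightarrow> bool" where
  "viscosity_subsolution \<Omega> \<Phi> v \<longleftrightarrow> usc_on \<Omega> v \<and>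
     (\<forall>\<phi> D\<phi>. C1_with_gradient \<Omega> \<phi> D\<phi> \<longrightarrow>
       (\<forall>x\<^sub>0. local_max_at \<Omega> (\<lambda>x. v x - \<phi> x) x\<^sub>0 \<longrightarrow> \<Phi> x\<^sub>0 (v x\<^sub>0) (D\<phi> x\<^sub>0) \<le> 0))"

definition viscosity_supersolution ::
  "'a::real_inner set \<Rightarrow> ('a \<Rightarrow> real \<Rightarrow> 'a \<Rightarrow> real) \<Rightarrow> ('a \<Rightarrow> real) \<Rightarrow> bool" where
  "viscosity_supersolution \<Omega> \<Phi> v \<longleftrightarrow> lsc_on \<Omega> v \<and>
     (\<forall>\<phi> D\<phi>. C1_with_gradient \<Omega> \<phi> D\<phi> \<longrightarrow>
       (\<forall>x\<^sub>0. local_min_at \<Omega> (\<lambda>x. v x - \<phi> x) x\<^sub>0 \<longrightarrow> \<Phi> x\<^sub>0 (v x\<^sub>0) (D\<phi> x\<^sub>0) \<ge> 0))"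

text \<open>
  The Baire operators and the graph completion are taken in the extended reals, since they can
  be infinite where \<open>f\<close> is not locally bounded; a finite interval is compared with a value of
  the graph completion through its image under \<open>ereal\<close>.
\<close>

definition upper_baire ::
  "'a::metric_space set \<Rightarrow> ('a \<Rightarrow> real interval) \<Rightarrow> 'a \<Rightarrow> ereal" where
  "upper_baire \<Omega> f x = (INF \<delta>\<in>{0<..}. SUP z\<in>(\<Union>y\<in>ball x \<delta> \<inter> \<Omega>. set_of (f y)). ereal z)"

definition lower_baire ::
  "'a::metric_space set \<Rightarrow> ('a \<Rightarrow> real interval) \<Rightarrow> 'a \<Rightarrow> ereal" where
  "lower_baire \<Omega> f x = (SUP \<delta>\<in>{0<..}. INF z\<in>(\<Union>y\<in>ball x \<delta> \<inter> \<Omega>. set_of (f y)). ereal z)"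

definition graph_completion ::
  "'a::metric_space set \<Rightarrow> ('a \<Rightarrow> real interval) \<Rightarrow> 'a \<Rightarrow> ereal set" where
  "graph_completion \<Omega> f x = {lower_baire \<Omega> f x .. upper_baire \<Omega> f x}"

definition S_continuous_on ::
  "'a::metric_space set \<Rightarrow> ('a \<Rightarrow> real interval) \<Rightarrow> bool" where
  "S_continuous_on \<Omega> f \<longleftrightarrow> (\<forall>x\<in>\<Omega>. graph_completion \<Omega> f x = ereal ` set_of (f x))"

definition H_continuous_on ::
  "'a::metric_space set \<Rightarrow> ('a \<Rightarrow> real interval) \<Rightarrow> bool" where
  "H_continuous_on \<Omega> f \<longleftrightarrow>
     (\<forall>g. (\<forall>x\<in>\<Omega>. set_of (g x) \<subseteq> set_of (f x)) \<longrightarrow>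
        (\<forall>x\<in>\<Omega>. graph_completion \<Omega> g x = ereal ` set_of (f x)))"

definition interval_fun_le ::
  "'a set \<Rightarrow> ('a \<Rightarrow> real interval) \<Rightarrow> ('a \<Rightarrow> real interval) \<Rightarrow> bool" where
  "interval_fun_le \<Omega> f g \<longleftrightarrow>
     (\<forall>x\<in>\<Omega>. lower (f x) \<le> lower (g x) \<and> upper (f x) \<le> upper (g x))"

definition viscosity_solution ::
  "'a::real_inner set \<Rightarrow> ('a \<Rightarrow> real \<Rightarrow> 'a \<Rightarrow> real) \<Rightarrow> ('a \<Rightarrow> real interval) \<Rightarrow> bool" where
  "viscosity_solution \<Omega> \<Phi> u \<longleftrightarrow> S_continuous_on \<Omega> u \<and>
     viscosity_supersolution \<Omega> \<Phi> (\<lambda>x. lower (u x)) \<and>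
     viscosity_subsolution \<Omega> \<Phi> (\<lambda>x. upper (u x))"

end

theory Submission
  imports Defs
begin

text \<open>
  Perron's method, run inside the H-continuous functions. Write \<open>p\<^sup>*\<close> and \<open>p\<^sub>*\<close> for the upper and lower
  semicontinuous envelopes of a real function \<open>p\<close>. A function \<open>f\<close> is H-continuous iff
  \<open>upper f = (lower f)\<^sup>*\<close> and \<open>lower f = (upper f)\<^sub>*\<close>, and every locally bounded lower semicontinuous \<open>p\<close> yields the
  H-continuous function \<open>[(p\<^sup>*)\<^sub>*, p\<^sup>*]\<close>. Let \<open>U\<close> be the set of H-continuous \<open>w\<close> between \<open>u\<^sub>1\<close> and \<open>u\<^sub>2\<close> for which
  \<open>upper w\<close> is a subsolution, let \<open>p\<close> be the supremum of the \<open>lower w\<close>, and let \<open>u = [(p\<^sup>*)\<^sub>*, p\<^sup>*]\<close>. Then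
  \<open>p\<^sup>*\<close> is also the upper envelope of the supremum of the \<open>upper w\<close>, hence a subsolution by
  Ishii's argument, so \<open>u\<close> is the largest element of \<open>U\<close>. If \<open>lower u\<close> failed to be a supersolution
  at \<open>x\<^sub>0\<close>, then \<open>lower u (x\<^sub>0) < lower u\<^sub>2 (x\<^sub>0)\<close>, and raising \<open>u\<close> near \<open>x\<^sub>0\<close> by a perturbed test function
  would give an element of \<open>U\<close> that is not below \<open>u\<close>.

  The supremum of all semicontinuous subsolutions between \<open>u\<^sub>1\<close> and \<open>u\<^sub>2\<close> would not do: for
  \<open>\<Phi>(x, r, p) = \<bar>x\<bar>\<^sup>2 r\<close> it can have an isolated upward spike at \<open>0\<close>, and its graph completion is then
  not H-continuous.
\<close>

subsection \<open>Semicontinuous functions and their envelopes\<close>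

lemma Ivl_bounds [simp]:
  "lower (Ivl a b) = min a b"
  "upper (Ivl a b) = b"
  by (simp_all add: lower.rep_eq upper.rep_eq Ivl.rep_eq)

text \<open>The filter \<open>at x within \<Omega>\<close> ignores the centre; the hypothesis
  \<open>P x\<close> puts it back, so that semicontinuity can be read off whole balls.\<close>

lemma eventually_at_within_iff_ball:
  assumes "P x"
  shows "(\<forall>\<^sub>F y in at x within \<Omega>. P y) \<longleftrightarrow> (\<exists>\<delta>>0. \<forall>y\<in>ball x \<delta> \<inter> \<Omega>. P y)"
proof -
  have "(\<forall>y\<in>\<Omega>. y \<noteq> x \<and> dist y x < \<delta> \<longrightarrow> P y) \<longleftrightarrow> (\<forall>y\<in>ball x \<delta> \<inter> \<Omega>. P y)" for \<delta>
    using assms by (auto simp: dist_commute)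
  then show ?thesis unfolding eventually_at by simp
qed

lemma usc_on_iff_ball:
  fixes v :: "'a::metric_space \<Rightarrow> real"
  shows "usc_on \<Omega> v \<longleftrightarrow> (\<forall>x\<in>\<Omega>. \<forall>c>v x. \<exists>\<delta>>0. \<forall>y\<in>ball x \<delta> \<inter> \<Omega>. v y < c)"
  unfolding usc_on_def by (simp add: eventually_at_within_iff_ball)

lemma lsc_on_iff_usc_on_uminus: "lsc_on \<Omega> v \<longleftrightarrow> usc_on \<Omega> (\<lambda>x. - v x)"
proof -
  have "(\<forall>c<a. P c) \<longleftrightarrow> (\<forall>c>-a. P (- c))" for a :: real and P
    by (metis minus_less_iff neg_less_iff_less minus_minus)
  then show ?thesis
    unfolding lsc_on_def usc_on_def by (simp add: minus_less_iff)
qed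

lemma lsc_on_iff_ball:
  fixes v :: "'a::metric_space \<Rightarrow> real"
  shows "lsc_on \<Omega> v \<longleftrightarrow> (\<forall>x\<in>\<Omega>. \<forall>c<v x. \<exists>\<delta>>0. \<forall>y\<in>ball x \<delta> \<inter> \<Omega>. c < v y)"
  unfolding lsc_on_def by (simp add: eventually_at_within_iff_ball)

lemma usc_on_diff_continuous:
  fixes v w :: "'a::metric_space \<Rightarrow> real"
  assumes "usc_on \<Omega> v" "continuous_on \<Omega> w"
  shows "usc_on \<Omega> (\<lambda>x. v x - w x)"
  unfolding usc_on_def
proof (intro ballI allI impI)
  fix x c assume x: "x \<in> \<Omega>" and c: "v x - w x < c"
  define e where "e = (c - (v x - w x)) / 2"
  have e: "e > 0" using c by (simp add: e_def)
  have "\<forall>\<^sub>F y in at x within \<Omega>. v y < v x + e"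
    using assms(1) x e by (auto simp: usc_on_def)
  moreover have "\<forall>\<^sub>F y in at x within \<Omega>. w x - e < w y"
    using assms(2) x e by (auto simp: continuous_on_def intro: order_tendstoD)
  ultimately show "\<forall>\<^sub>F y in at x within \<Omega>. v y - w y < c"
    by eventually_elim (simp add: e_def field_simps)
qed

text \<open>Without a maximum every \<open>x\<close> in \<open>K\<close> has some \<open>a x\<close>
  in \<open>K\<close> with a larger value, and \<open>v < v (a x)\<close> on a ball about
  \<open>x\<close>. Finitely many balls cover \<open>K\<close>; the best of the finitely many points
  \<open>a x\<close> lies in one of them, which contradicts its being the best.\<close>

lemma usc_on_attains_max:
  fixes v :: "'a::metric_space \<Rightarrow> real"
  assumes v: "usc_on \<Omega> v" and K: "compact K" "K \<noteq> {}" "K \<subseteq> \<Omega>"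
  shows "\<exists>x\<in>K. \<forall>y\<in>K. v y \<le> v x"
proof (rule ccontr)
  assume "\<not> ?thesis"
  then obtain a where a: "\<And>x. x \<in> K \<Longrightarrow> a x \<in> K \<and> v x < v (a x)"
    by (metis not_le)
  have "\<forall>x\<in>K. \<exists>\<delta>>0. \<forall>y\<in>ball x \<delta> \<inter> \<Omega>. v y < v (a x)"
    using v a K(3) unfolding usc_on_iff_ball by blast
  then obtain d where d: "\<And>x. x \<in> K \<Longrightarrow> d x > 0 \<and> (\<forall>y\<in>ball x (d x) \<inter> \<Omega>. v y < v (a x))"
    by metis
  obtain C where C: "C \<subseteq> K" "finite C" "K \<subseteq> (\<Union>x\<in>C. ball x (d x))"
  proof (rule compactE_image[OF K(1), of K "\<lambda>x. ball x (d x)"])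
    show "K \<subseteq> (\<Union>x\<in>K. ball x (d x))" using d by force
  qed auto
  have "C \<noteq> {}" using C K by auto
  define M where "M = Max ((\<lambda>x. v (a x)) ` C)"
  have "M \<in> (\<lambda>x. v (a x)) ` C" unfolding M_def using C(2) \<open>C \<noteq> {}\<close> by (intro Max_in) auto
  then obtain m where "m \<in> C" "M = v (a m)" by blast
  moreover have "v (a x) \<le> M" if "x \<in> C" for x
    unfolding M_def using C(2) that by simp
  ultimately have m: "m \<in> C" "\<And>x. x \<in> C \<Longrightarrow> v (a x) \<le> v (a m)" by auto
  have "a m \<in> K" using a m C by blast
  then obtain x where "x \<in> C" "a m \<in> ball x (d x)" using C by blast
  then have "v (a m) < v (a x)" using d C K \<open>a m \<in> K\<close> by blast
  then show False using m(2)[OF \<open>x \<in> C\<close>] by simp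
qed

text \<open>The envelope at \<open>x\<close> is the infimum of the bounds for \<open>p\<close> that
  hold on some ball about \<open>x\<close>; the majorant \<open>q\<close> keeps it finite. It is
  upper semicontinuous because a bound on a ball about \<open>x\<close> is also one on a smaller
  ball about each point inside. The last clause encodes minimality.\<close>

lemma usc_envelope_exists:
  fixes p q :: "'a::metric_space \<Rightarrow> real"
  assumes q: "usc_on \<Omega> q" and pq: "\<And>x. x \<in> \<Omega> \<Longrightarrow> p x \<le> q x"
  shows "\<exists>v. usc_on \<Omega> v \<and> (\<forall>x\<in>\<Omega>. p x \<le> v x) \<and>
    (\<forall>x\<in>\<Omega>. \<forall>c<v x. \<forall>\<delta>>0. \<exists>y\<in>ball x \<delta> \<inter> \<Omega>. c < p y)"
proof -
  define A where "A x = {c. \<exists>\<delta>>0. \<forall>y\<in>ball x \<delta> \<inter> \<Omega>. p y \<le> c}" for x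
  define v where "v x = Inf (A x)" for x
  have ne: "A x \<noteq> {}" if x: "x \<in> \<Omega>" for x
  proof -
    obtain \<delta> where "\<delta> > 0" "\<forall>y\<in>ball x \<delta> \<inter> \<Omega>. q y < q x + 1"
      using q[unfolded usc_on_iff_ball, rule_format, OF x, of "q x + 1"] by auto
    moreover have "p y \<le> q x + 1" if "y \<in> ball x \<delta> \<inter> \<Omega>" for y
      using calculation(2)[rule_format, OF that] pq[of y] that by simp
    ultimately have "q x + 1 \<in> A x" unfolding A_def by blast
    then show ?thesis by blast
  qed
  have lb: "p x \<le> c" if "x \<in> \<Omega>" "c \<in> A x" for x c
    using that unfolding A_def by auto
  have bdd: "bdd_below (A x)" if "x \<in> \<Omega>" for x
    using lb that by (meson bdd_belowI)
  have "usc_on \<Omega> v"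
    unfolding usc_on_iff_ball
  proof (intro ballI allI impI)
    fix x c assume x: "x \<in> \<Omega>" and "v x < c"
    then obtain a where a: "a \<in> A x" "a < c"
      unfolding v_def using cInf_less_iff[OF ne bdd] by blast
    then obtain \<delta> where \<delta>: "\<delta> > 0" "\<forall>y\<in>ball x \<delta> \<inter> \<Omega>. p y \<le> a" unfolding A_def by auto
    have "v y < c" if y: "y \<in> ball x \<delta> \<inter> \<Omega>" for y
    proof -
      obtain e where e: "e > 0" "ball y e \<subseteq> ball x \<delta>"
        using y by (meson IntD1 open_ball openE)
      then have "a \<in> A y" unfolding A_def using \<delta> by blast
      then have "v y \<le> a" unfolding v_def using bdd y by (auto intro: cInf_lower)
      then show ?thesis using a by simp
    qed
    then show "\<exists>\<delta>>0. \<forall>y\<in>ball x \<delta> \<inter> \<Omega>. v y < c" using \<delta> by blast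
  qed
  moreover have "p x \<le> v x" if "x \<in> \<Omega>" for x
    unfolding v_def using ne lb that by (auto intro: cInf_greatest)
  moreover have "\<exists>y\<in>ball x \<delta> \<inter> \<Omega>. c < p y" if "x \<in> \<Omega>" "c < v x" "\<delta> > 0" for x c \<delta>
  proof (rule ccontr)
    assume "\<not> ?thesis"
    then have "c \<in> A x" unfolding A_def using that by force
    then have "v x \<le> c" unfolding v_def using bdd that by (auto intro: cInf_lower)
    then show False using that by simp
  qed
  ultimately show ?thesis by blast
qed

lemma lsc_envelope_exists:
  fixes p q :: "'a::metric_space \<Rightarrow> real"
  assumes q: "lsc_on \<Omega> q" and pq: "\<And>x. x \<in> \<Omega> \<Longrightarrow> q x \<le> p x"
  shows "\<exists>v. lsc_on \<Omega> v \<and> (\<forall>x\<in>\<Omega>. v x \<le> p x) \<and>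
    (\<forall>x\<in>\<Omega>. \<forall>c>v x. \<forall>\<delta>>0. \<exists>y\<in>ball x \<delta> \<inter> \<Omega>. p y < c)"
proof -
  obtain v where v: "usc_on \<Omega> v" "\<forall>x\<in>\<Omega>. - p x \<le> v x"
    "\<forall>x\<in>\<Omega>. \<forall>c<v x. \<forall>\<delta>>0. \<exists>y\<in>ball x \<delta> \<inter> \<Omega>. c < - p y"
    using usc_envelope_exists[of \<Omega> "\<lambda>x. - q x" "\<lambda>x. - p x"] assms
    unfolding lsc_on_iff_usc_on_uminus by auto
  have "lsc_on \<Omega> (\<lambda>x. - v x)" using v(1) unfolding lsc_on_iff_usc_on_uminus by simp
  moreover have "\<forall>x\<in>\<Omega>. - v x \<le> p x" using v(2) by (simp add: minus_le_iff)
  moreover have "\<exists>y\<in>ball x \<delta> \<inter> \<Omega>. p y < c" if x: "x \<in> \<Omega>" "- v x < c" "\<delta> > 0" for x c \<delta>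
  proof -
    have "- c < v x" using x by linarith
    then obtain y where "y \<in> ball x \<delta> \<inter> \<Omega>" "- c < - p y" using v(3) x(1,3) by blast
    then show ?thesis by auto
  qed
  ultimately show ?thesis by blast
qed

text \<open>This turns the approximation clause of the envelope into minimality: a \<open>c\<close>
  strictly between \<open>q x\<close> and \<open>v x\<close> would bound \<open>q\<close> from above
  near \<open>x\<close>, yet be exceeded there by a value of \<open>p\<close>.\<close>

lemma le_usc_on_of_le_dense:
  fixes p q v :: "'a::metric_space \<Rightarrow> real"
  assumes "usc_on \<Omega> q" "\<And>y. y \<in> \<Omega> \<Longrightarrow> p y \<le> q y" "x \<in> \<Omega>"
    and "\<And>c \<delta>. c < v x \<Longrightarrow> \<delta> > 0 \<Longrightarrow> \<exists>y\<in>ball x \<delta> \<inter> \<Omega>. c < p y"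
  shows "v x \<le> q x"
proof (rule ccontr)
  assume "\<not> ?thesis"
  then obtain c where c: "q x < c" "c < v x" using dense not_le by blast
  obtain \<delta> where "\<delta> > 0" "\<forall>y\<in>ball x \<delta> \<inter> \<Omega>. q y < c"
    using assms(1,3) c unfolding usc_on_iff_ball by blast
  with assms(4)[OF c(2)] assms(2) show False by force
qed

lemma lsc_on_le_of_dense_le:
  fixes p q v :: "'a::metric_space \<Rightarrow> real"
  assumes "lsc_on \<Omega> q" "\<And>y. y \<in> \<Omega> \<Longrightarrow> q y \<le> p y" "x \<in> \<Omega>"
    and "\<And>c \<delta>. v x < c \<Longrightarrow> \<delta> > 0 \<Longrightarrow> \<exists>y\<in>ball x \<delta> \<inter> \<Omega>. p y < c"
  shows "q x \<le> v x"
proof (rule ccontr)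
  assume "\<not> ?thesis"
  then obtain c where c: "v x < c" "c < q x" using dense not_le by blast
  obtain \<delta> where "\<delta> > 0" "\<forall>y\<in>ball x \<delta> \<inter> \<Omega>. c < q y"
    using assms(1,3) c unfolding lsc_on_iff_ball by blast
  with assms(4)[OF c(1)] assms(2) show False by force
qed

subsection \<open>H-continuity through the endpoint functions\<close>

text \<open>The two clauses are the inequalities \<open>\<le>\<close> and \<open>\<ge>\<close>
  without extended reals. Only upper endpoints occur because they decide the supremum over each
  interval. The clauses match upper semicontinuity and the approximation clause of the
  envelope.\<close>

lemma upper_baire_eq_ereal_iff:
  "upper_baire \<Omega> g x = ereal b \<longleftrightarrow>
    (\<forall>c>b. \<exists>\<delta>>0. \<forall>y\<in>ball x \<delta> \<inter> \<Omega>. upper (g y) < c) \<and>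
    (\<forall>c<b. \<forall>\<delta>>0. \<exists>y\<in>ball x \<delta> \<inter> \<Omega>. c < upper (g y))"
proof -
  define s where "s \<delta> = (SUP z\<in>(\<Union>y\<in>ball x \<delta> \<inter> \<Omega>. set_of (g y)). ereal z)" for \<delta>
  have s_ge: "ereal (upper (g y)) \<le> s \<delta>" if "y \<in> ball x \<delta> \<inter> \<Omega>" for y \<delta>
    unfolding s_def
  proof (rule SUP_upper)
    show "upper (g y) \<in> (\<Union>y\<in>ball x \<delta> \<inter> \<Omega>. set_of (g y))"
      using that by (intro UN_I) (auto simp: set_of_eq)
  qed
  have s: "ereal c < s \<delta> \<longleftrightarrow> (\<exists>y\<in>ball x \<delta> \<inter> \<Omega>. c < upper (g y))" for c \<delta>
  proof
    assume "ereal c < s \<delta>"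
    then show "\<exists>y\<in>ball x \<delta> \<inter> \<Omega>. c < upper (g y)"
      unfolding s_def less_SUP_iff set_of_eq by (clarsimp, metis less_le_trans IntI mem_ball)
  next
    assume "\<exists>y\<in>ball x \<delta> \<inter> \<Omega>. c < upper (g y)"
    then show "ereal c < s \<delta>"
      using s_ge by (meson less_ereal.simps(1) less_le_trans)
  qed
  have ub: "upper_baire \<Omega> g x = (INF \<delta>\<in>{0<..}. s \<delta>)" by (simp add: upper_baire_def s_def)
  have lt: "upper_baire \<Omega> g x < ereal c \<longleftrightarrow> (\<exists>\<delta>>0. s \<delta> < ereal c)" for c
    unfolding ub INF_less_iff by auto
  have le: "ereal c \<le> upper_baire \<Omega> g x \<longleftrightarrow> (\<forall>\<delta>>0. ereal c \<le> s \<delta>)" for c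
    unfolding ub le_INF_iff by auto
  have "upper_baire \<Omega> g x \<le> ereal b \<longleftrightarrow> (\<forall>c>b. \<exists>\<delta>>0. \<forall>y\<in>ball x \<delta> \<inter> \<Omega>. upper (g y) < c)"
  proof (intro iffI allI impI)
    fix c assume "upper_baire \<Omega> g x \<le> ereal b" "c > b"
    then obtain \<delta> where "\<delta> > 0" "s \<delta> < ereal c"
      using lt[of c] le_less_trans[of _ "ereal b" "ereal c"] by auto
    then show "\<exists>\<delta>>0. \<forall>y\<in>ball x \<delta> \<inter> \<Omega>. upper (g y) < c"
      using s_ge by (meson le_less_trans less_ereal.simps(1))
  next
    assume *: "\<forall>c>b. \<exists>\<delta>>0. \<forall>y\<in>ball x \<delta> \<inter> \<Omega>. upper (g y) < c"
    show "upper_baire \<Omega> g x \<le> ereal b"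
    proof (rule ccontr)
      assume "\<not> ?thesis"
      then obtain c where c: "b < c" "ereal c < upper_baire \<Omega> g x"
        using ereal_dense2[of "ereal b" "upper_baire \<Omega> g x"] by (auto simp: not_le)
      then obtain \<delta> where \<delta>: "\<delta> > 0" "\<forall>y\<in>ball x \<delta> \<inter> \<Omega>. upper (g y) < c" using * by blast
      then have "s \<delta> \<le> ereal c"
        unfolding s_def
        by (intro SUP_least) (auto simp: set_of_eq dest!: bspec intro: order_trans less_imp_le)
      moreover have "upper_baire \<Omega> g x \<le> s \<delta>"
        unfolding ub using \<delta>(1) by (simp add: INF_lower)
      ultimately have "\<not> ereal c < upper_baire \<Omega> g x" by (simp add: not_less)
      then show False using c by simp
    qed
  qed
  moreover have "ereal b \<le> upper_baire \<Omega> g x \<longleftrightarrow>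
      (\<forall>c<b. \<forall>\<delta>>0. \<exists>y\<in>ball x \<delta> \<inter> \<Omega>. c < upper (g y))"
    unfolding le s[symmetric]
  proof (intro iffI allI impI)
    fix c \<delta> assume *: "\<forall>\<delta>>0. ereal b \<le> s \<delta>" "c < b" "(\<delta>::real) > 0"
    have "ereal c < ereal b" using * by simp
    also have "\<dots> \<le> s \<delta>" using * by blast
    finally show "ereal c < s \<delta>" .
  next
    fix \<delta> :: real assume *: "\<forall>c<b. \<forall>\<delta>>0. ereal c < s \<delta>" "\<delta> > 0"
    show "ereal b \<le> s \<delta>"
    proof (rule ccontr)
      assume "\<not> ?thesis"
      then obtain c where "s \<delta> < ereal c" "c < b"
        using ereal_dense2[of "s \<delta>" "ereal b"] by (auto simp: not_le)
      then show False using * by (meson less_asym)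
    qed
  qed
  ultimately show ?thesis by (metis antisym order_refl)
qed

text \<open>Negating an interval swaps its endpoints up to sign, so facts on the lower operator
  follow by reflection.\<close>

lemma lower_baire_eq_uminus_upper_baire:
  "lower_baire \<Omega> g x = - upper_baire \<Omega> (\<lambda>y. - g y) x"
proof -
  have "(\<Union>y\<in>ball x \<delta> \<inter> \<Omega>. set_of (- g y)) = uminus ` (\<Union>y\<in>ball x \<delta> \<inter> \<Omega>. set_of (g y))" for \<delta>
    by (simp add: image_UN set_of_eq)
  then show ?thesis
    unfolding lower_baire_def upper_baire_def
    by (simp add: image_image ereal_SUP_uminus_eq ereal_INF_uminus_eq del: uminus_ereal.simps flip: uminus_ereal.simps)
qed

lemma lower_baire_eq_ereal_iff:
  "lower_baire \<Omega> g x = ereal b \<longleftrightarrow>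
    (\<forall>c<b. \<exists>\<delta>>0. \<forall>y\<in>ball x \<delta> \<inter> \<Omega>. c < lower (g y)) \<and>
    (\<forall>c>b. \<forall>\<delta>>0. \<exists>y\<in>ball x \<delta> \<inter> \<Omega>. lower (g y) < c)"
proof -
  have 1: "(\<forall>c>(- b). P c) \<longleftrightarrow> (\<forall>c<b. P (- c))" for P
    by (metis minus_less_iff neg_less_iff_less minus_minus)
  have 2: "(\<forall>c<(- b). P c) \<longleftrightarrow> (\<forall>c>b. P (- c))" for P
    by (metis minus_less_iff neg_less_iff_less minus_minus)
  have "lower_baire \<Omega> g x = ereal b \<longleftrightarrow> upper_baire \<Omega> (\<lambda>y. - g y) x = ereal (- b)"
    unfolding lower_baire_eq_uminus_upper_baire
    by (metis ereal_uminus_uminus uminus_ereal.simps(1))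
  also have "\<dots> \<longleftrightarrow> (\<forall>c<b. \<exists>\<delta>>0. \<forall>y\<in>ball x \<delta> \<inter> \<Omega>. c < lower (g y)) \<and>
    (\<forall>c>b. \<forall>\<delta>>0. \<exists>y\<in>ball x \<delta> \<inter> \<Omega>. lower (g y) < c)"
    unfolding upper_baire_eq_ereal_iff 1 2 by simp
  finally show ?thesis .
qed

lemma graph_completion_eq_iff:
  "graph_completion \<Omega> g x = ereal ` set_of J \<longleftrightarrow>
    lower_baire \<Omega> g x = ereal (lower J) \<and> upper_baire \<Omega> g x = ereal (upper J)"
proof -
  have "ereal ` {a..b} = {ereal a..ereal b}" for a b
  proof (rule set_eqI)
    show "z \<in> ereal ` {a..b} \<longleftrightarrow> z \<in> {ereal a..ereal b}" for z
      by (cases z) (auto simp: image_iff)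
  qed
  then show ?thesis
    unfolding graph_completion_def set_of_eq by (simp add: Icc_eq_Icc)
qed

text \<open>For the forward direction three choices of \<open>g\<close> suffice: \<open>f\<close>
  itself and the two degenerate functions given by its endpoints. Conversely, the endpoints of any
  \<open>g\<close> inside \<open>f\<close> lie between those of \<open>f\<close>: semicontinuity
  bounds them from outside, and the crossed approximation clauses show that the bounds are
  reached.\<close>

lemma H_continuous_on_iff:
  "H_continuous_on \<Omega> f \<longleftrightarrow>
    usc_on \<Omega> (\<lambda>x. upper (f x)) \<and> lsc_on \<Omega> (\<lambda>x. lower (f x)) \<and>
    (\<forall>x\<in>\<Omega>. \<forall>c<upper (f x). \<forall>\<delta>>0. \<exists>y\<in>ball x \<delta> \<inter> \<Omega>. c < lower (f y)) \<and>
    (\<forall>x\<in>\<Omega>. \<forall>c>lower (f x). \<forall>\<delta>>0. \<exists>y\<in>ball x \<delta> \<inter> \<Omega>. upper (f y) < c)"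
    (is "_ \<longleftrightarrow> ?usc \<and> ?lsc \<and> ?up \<and> ?low")
proof
  assume H: "H_continuous_on \<Omega> f"
  have *: "lower_baire \<Omega> g x = ereal (lower (f x)) \<and> upper_baire \<Omega> g x = ereal (upper (f x))"
    if "x \<in> \<Omega>" "\<And>x. set_of (g x) \<subseteq> set_of (f x)" for x g
    using H that unfolding H_continuous_on_def graph_completion_eq_iff by blast
  have "set_of (Ivl (lower (f x)) (lower (f x))) \<subseteq> set_of (f x)" for x
    by (simp add: set_of_eq lower_le_upper)
  from *[OF _ this] have ?up
    unfolding upper_baire_eq_ereal_iff by simp
  have "set_of (Ivl (upper (f x)) (upper (f x))) \<subseteq> set_of (f x)" for x
    by (simp add: set_of_eq lower_le_upper)
  from *[OF _ this] have ?low
    unfolding lower_baire_eq_ereal_iff by simp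
  show "?usc \<and> ?lsc \<and> ?up \<and> ?low"
    using *[of _ f] \<open>?up\<close> \<open>?low\<close>
    unfolding lower_baire_eq_ereal_iff upper_baire_eq_ereal_iff usc_on_iff_ball lsc_on_iff_ball
    by simp
next
  assume R: "?usc \<and> ?lsc \<and> ?up \<and> ?low"
  show "H_continuous_on \<Omega> f"
    unfolding H_continuous_on_def graph_completion_eq_iff
      lower_baire_eq_ereal_iff upper_baire_eq_ereal_iff
  proof (intro allI ballI impI conjI)
    fix g x assume g: "\<forall>x\<in>\<Omega>. set_of (g x) \<subseteq> set_of (f x)" and x: "x \<in> \<Omega>"
    have gf: "lower (f y) \<le> lower (g y)" "lower (f y) \<le> upper (g y)"
      "lower (g y) \<le> upper (f y)" "upper (g y) \<le> upper (f y)" if "y \<in> \<Omega>" for y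
    proof -
      have "lower (g y) \<in> set_of (f y)" "upper (g y) \<in> set_of (f y)"
        using g that by (auto simp: set_of_eq subset_iff)
      then show "lower (f y) \<le> lower (g y)" "lower (f y) \<le> upper (g y)"
        "lower (g y) \<le> upper (f y)" "upper (g y) \<le> upper (f y)"
        by (auto simp: set_of_eq)
    qed
    {
      fix c assume "c < lower (f x)"
      then obtain \<delta> where \<delta>: "\<delta> > 0" "\<forall>y\<in>ball x \<delta> \<inter> \<Omega>. c < lower (f y)"
        using R x unfolding lsc_on_iff_ball by blast
      have "c < lower (g y)" if "y \<in> ball x \<delta> \<inter> \<Omega>" for y
        using \<delta>(2)[rule_format, OF that] gf(1)[of y] that by simp
      then show "\<exists>\<delta>>0. \<forall>y\<in>ball x \<delta> \<inter> \<Omega>. c < lower (g y)"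
        using \<delta>(1) by blast
    next
      fix c \<delta> :: real assume "lower (f x) < c" "\<delta> > 0"
      then obtain y where "y \<in> ball x \<delta> \<inter> \<Omega>" "upper (f y) < c" using R x by blast
      then show "\<exists>y\<in>ball x \<delta> \<inter> \<Omega>. lower (g y) < c"
        using gf(3)[of y] by (intro bexI[of _ y]) auto
    next
      fix c assume "upper (f x) < c"
      then obtain \<delta> where \<delta>: "\<delta> > 0" "\<forall>y\<in>ball x \<delta> \<inter> \<Omega>. upper (f y) < c"
        using R x unfolding usc_on_iff_ball by blast
      have "upper (g y) < c" if "y \<in> ball x \<delta> \<inter> \<Omega>" for y
        using \<delta>(2)[rule_format, OF that] gf(4)[of y] that by simp
      then show "\<exists>\<delta>>0. \<forall>y\<in>ball x \<delta> \<inter> \<Omega>. upper (g y) < c"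
        using \<delta>(1) by blast
    next
      fix c \<delta> :: real assume "c < upper (f x)" "\<delta> > 0"
      then obtain y where "y \<in> ball x \<delta> \<inter> \<Omega>" "c < lower (f y)" using R x by blast
      then show "\<exists>y\<in>ball x \<delta> \<inter> \<Omega>. c < upper (g y)"
        using gf(2)[of y] by (intro bexI[of _ y]) auto
    }
  qed
qed

lemma H_continuous_on_imp_S_continuous_on:
  "H_continuous_on \<Omega> f \<Longrightarrow> S_continuous_on \<Omega> f"
  unfolding H_continuous_on_def S_continuous_on_def by blast

text \<open>The weakest comparison is enough: \<open>upper g\<close> is an upper semicontinuous
  majorant of \<open>lower f\<close>, whose envelope is \<open>upper f\<close>; dually for the lower
  endpoints.\<close>

lemma interval_fun_le_of_lower_le_upper:
  assumes f: "H_continuous_on \<Omega> f" and g: "H_continuous_on \<Omega> g"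
    and le: "\<And>x. x \<in> \<Omega> \<Longrightarrow> lower (f x) \<le> upper (g x)"
  shows "interval_fun_le \<Omega> f g"
  unfolding interval_fun_le_def
proof (intro ballI conjI)
  fix x assume x: "x \<in> \<Omega>"
  show "upper (f x) \<le> upper (g x)"
  proof (rule le_usc_on_of_le_dense[OF _ le x])
    show "usc_on \<Omega> (\<lambda>x. upper (g x))"
      using g by (simp add: H_continuous_on_iff)
    show "\<exists>y\<in>ball x \<delta> \<inter> \<Omega>. c < lower (f y)" if "c < upper (f x)" "\<delta> > 0" for c \<delta>
      using f x that by (simp add: H_continuous_on_iff)
  qed
  show "lower (f x) \<le> lower (g x)"
  proof (rule lsc_on_le_of_dense_le[OF _ le x])
    show "lsc_on \<Omega> (\<lambda>x. lower (f x))"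
      using f by (simp add: H_continuous_on_iff)
    show "\<exists>y\<in>ball x \<delta> \<inter> \<Omega>. upper (g y) < c" if "lower (g x) < c" "\<delta> > 0" for c \<delta>
      using g x that by (simp add: H_continuous_on_iff)
  qed
qed

text \<open>The interval runs from the lower envelope of \<open>v\<close> to \<open>v\<close>, where
  \<open>v\<close> is the upper envelope of \<open>p\<close>; \<open>q\<close> ensures that
  \<open>v\<close> is finite. The last conclusion records that \<open>upper u\<close> is no larger
  than this envelope.\<close>

lemma H_continuous_on_above_lsc:
  fixes p q :: "'a::metric_space \<Rightarrow> real"
  assumes p: "lsc_on \<Omega> p" and q: "usc_on \<Omega> q" and pq: "\<And>x. x \<in> \<Omega> \<Longrightarrow> p x \<le> q x"
  obtains u where "H_continuous_on \<Omega> u" "\<And>x. x \<in> \<Omega> \<Longrightarrow> p x \<le> lower (u x)"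
    "\<And>x c \<delta>. x \<in> \<Omega> \<Longrightarrow> c < upper (u x) \<Longrightarrow> \<delta> > 0 \<Longrightarrow> \<exists>y\<in>ball x \<delta> \<inter> \<Omega>. c < p y"
proof -
  obtain v where v: "usc_on \<Omega> v" "\<And>x. x \<in> \<Omega> \<Longrightarrow> p x \<le> v x"
    "\<And>x c \<delta>. x \<in> \<Omega> \<Longrightarrow> c < v x \<Longrightarrow> \<delta> > 0 \<Longrightarrow> \<exists>y\<in>ball x \<delta> \<inter> \<Omega>. c < p y"
    using usc_envelope_exists[of \<Omega> q p, OF q pq] by blast
  obtain l where l: "lsc_on \<Omega> l" "\<And>x. x \<in> \<Omega> \<Longrightarrow> l x \<le> v x"
    "\<And>x c \<delta>. x \<in> \<Omega> \<Longrightarrow> l x < c \<Longrightarrow> \<delta> > 0 \<Longrightarrow> \<exists>y\<in>ball x \<delta> \<inter> \<Omega>. v y < c"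
    using lsc_envelope_exists[of \<Omega> p v, OF p v(2)] by blast
  \<comment> \<open>Here lower semicontinuity of \<open>p\<close> is decisive: with
    \<open>p \<le> l\<close>, the values of \<open>p\<close> that approximate \<open>v\<close> can
    be replaced by values of \<open>l\<close>, as H-continuity of \<open>u\<close> demands.\<close>
  have pl: "p x \<le> l x" if "x \<in> \<Omega>" for x
    using p v(2) that l(3)[OF that] by (rule lsc_on_le_of_dense_le)
  \<comment> \<open>\<open>Ivl\<close> caps the lower endpoint at the upper one, so
    \<open>lower (u x) = l x\<close> is available only on \<open>\<Omega>\<close>, where
    \<open>l \<le> v\<close>.\<close>
  define u where "u x = Ivl (l x) (v x)" for x
  have u: "upper (u x) = v x" for x by (simp add: u_def)
  have u': "lower (u x) = l x" if "x \<in> \<Omega>" for x using l(2) that by (simp add: u_def)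
  have "H_continuous_on \<Omega> u"
    unfolding H_continuous_on_iff
  proof (intro conjI ballI allI impI)
    show "lsc_on \<Omega> (\<lambda>x. lower (u x))"
      using l(1) unfolding lsc_on_iff_ball by (simp add: u')
    show "\<exists>y\<in>ball x \<delta> \<inter> \<Omega>. c < lower (u y)" if x: "x \<in> \<Omega>" "c < upper (u x)" "\<delta> > 0" for x c \<delta>
    proof -
      obtain y where "y \<in> ball x \<delta> \<inter> \<Omega>" "c < p y"
        using v(3)[OF x(1) _ x(3), of c] x(2) by (auto simp: u)
      then show ?thesis using pl[of y] u'[of y] by (intro bexI[of _ y]) auto
    qed
    show "\<exists>y\<in>ball x \<delta> \<inter> \<Omega>. upper (u y) < c" if "x \<in> \<Omega>" "lower (u x) < c" "\<delta> > 0" for x c \<delta>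
      using l(3) that by (simp add: u u')
  qed (simp add: u v(1))
  then show thesis
  proof (rule that)
    show "p x \<le> lower (u x)" if "x \<in> \<Omega>" for x
      using pl u' that by simp
    show "\<exists>y\<in>ball x \<delta> \<inter> \<Omega>. c < p y" if "x \<in> \<Omega>" "c < upper (u x)" "\<delta> > 0" for x c \<delta>
      using v(3) that by (simp add: u)
  qed
qed

subsection \<open>Perron's method\<close>

lemma C1_with_gradient_imp_continuous_on:
  assumes "C1_with_gradient \<Omega> \<phi> D" shows "continuous_on \<Omega> \<phi>"
  using assms has_derivative_continuous unfolding C1_with_gradient_def gderiv_def
  by (blast intro: continuous_at_imp_continuous_on)

text \<open>The added gradient vanishes at \<open>a\<close>. So a touching at \<open>a\<close> can
  be made strict, from above with \<open>c = 1\<close> or from below with \<open>c = -1\<close>,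
  without changing the inequality tested there.\<close>

lemma C1_with_gradient_add_paraboloid:
  assumes "C1_with_gradient \<Omega> \<phi> D"
  shows "C1_with_gradient \<Omega> (\<lambda>x. \<phi> x + (k + c * (norm (x - a))\<^sup>2)) (\<lambda>x. D x + (2 * c) *\<^sub>R (x - a))"
  unfolding C1_with_gradient_def
proof (intro conjI ballI)
  fix x assume "x \<in> \<Omega>"
  then have "GDERIV \<phi> x :> D x" using assms by (simp add: C1_with_gradient_def)
  moreover have "GDERIV (\<lambda>x. k + c * (norm (x - a))\<^sup>2) x :> (2 * c) *\<^sub>R (x - a)"
    unfolding gderiv_def power2_norm_eq_inner
    by (auto intro!: derivative_eq_intros simp: fun_eq_iff inner_commute algebra_simps)
  ultimately show "GDERIV (\<lambda>x. \<phi> x + (k + c * (norm (x - a))\<^sup>2)) x :> D x + (2 * c) *\<^sub>R (x - a)"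
    by (rule GDERIV_add)
next
  show "continuous_on \<Omega> (\<lambda>x. D x + (2 * c) *\<^sub>R (x - a))"
    using assms unfolding C1_with_gradient_def by (intro continuous_intros) auto
qed

lemma GDERIV_eq_of_local_max:
  assumes "GDERIV f x :> D" "GDERIV g x :> E" "\<delta> > 0"
    and max: "\<And>y. y \<in> ball x \<delta> \<Longrightarrow> f y - g y \<le> f x - g x"
  shows "D = E"
proof -
  have "((\<lambda>y. f y - g y) has_derivative (\<lambda>h. h \<bullet> (D - E))) (at x)"
    using GDERIV_diff[OF assms(1,2)] by (simp add: gderiv_def)
  then have "(\<lambda>h. h \<bullet> (D - E)) = (\<lambda>h. 0)"
    by (rule differential_zero_maxmin[of x "ball x \<delta>", rotated 2]) (use assms in auto)
  then have "(D - E) \<bullet> (D - E) = 0" by (rule fun_cong)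
  then show ?thesis by simp
qed

lemma continuous_at_ball_bound:
  fixes f :: "'a::metric_space \<Rightarrow> real"
  assumes "continuous_on \<Omega> f" "x \<in> \<Omega>" "e > 0"
  obtains \<delta> where "\<delta> > 0" "\<And>y. y \<in> \<Omega> \<Longrightarrow> dist y x < \<delta> \<Longrightarrow> \<bar>f y - f x\<bar> < e"
  using assms unfolding continuous_on_iff dist_real_def by metis

text \<open>The gradient slot is filled by the continuous field \<open>G\<close>, so nearness is
  only needed in the point and in the value. It serves for \<open>\<Phi>\<close> with subsolutions
  and for \<open>- \<Phi>\<close> with the bump.\<close>

lemma positive_near_of_continuous_on:
  fixes \<Psi> :: "'a::metric_space \<Rightarrow> real \<Rightarrow> 'b::topological_space \<Rightarrow> real"
  assumes \<Psi>: "continuous_on (\<Omega> \<times> UNIV \<times> UNIV) (\<lambda>(x, r, p). \<Psi> x r p)"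
    and G: "continuous_on \<Omega> G" and x: "x \<in> \<Omega>" and pos: "0 < \<Psi> x r (G x)"
  obtains e where "e > 0"
    "\<And>z s. z \<in> \<Omega> \<Longrightarrow> dist z x < e \<Longrightarrow> \<bar>s - r\<bar> < e \<Longrightarrow> 0 < \<Psi> z s (G z)"
proof -
  have "continuous_on (\<Omega> \<times> UNIV) (\<lambda>y. (fst y, snd y, G (fst y)))"
    by (intro continuous_intros continuous_on_compose2[OF G]) auto
  then have "continuous_on (\<Omega> \<times> UNIV) (\<lambda>y. (\<lambda>(x, r, p). \<Psi> x r p) (fst y, snd y, G (fst y)))"
    by (intro continuous_on_compose2[OF \<Psi>]) auto
  then have "continuous_on (\<Omega> \<times> UNIV) (\<lambda>y. \<Psi> (fst y) (snd y) (G (fst y)))" by simp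
  from continuous_at_ball_bound[OF this, of "(x, r)" "\<Psi> x r (G x)"] x pos
  obtain d where d: "d > 0" "\<And>y. y \<in> \<Omega> \<times> UNIV \<Longrightarrow> dist y (x, r) < d \<Longrightarrow>
      \<bar>\<Psi> (fst y) (snd y) (G (fst y)) - \<Psi> x r (G x)\<bar> < \<Psi> x r (G x)"
    by (metis SigmaI UNIV_I fst_conv snd_conv)
  show thesis
  proof (rule that)
    show "d / 2 > 0" using d by simp
    fix z s assume z: "z \<in> \<Omega>" "dist z x < d / 2" "\<bar>s - r\<bar> < d / 2"
    have "dist (z, s) (x, r) \<le> dist z x + \<bar>s - r\<bar>"
      unfolding dist_Pair_Pair dist_real_def by (rule order_trans[OF sqrt_sum_squares_le_sum_abs]) simp
    then have "dist (z, s) (x, r) < d" using z by simp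
    then have "\<bar>\<Psi> z s (G z) - \<Psi> x r (G x)\<bar> < \<Psi> x r (G x)"
      using d(2)[of "(z, s)"] z by simp
    then show "0 < \<Psi> z s (G z)" by linarith
  qed
qed

text \<open>No member of \<open>W\<close> need come near \<open>v\<close> at \<open>x0\<close>
  itself, only at points close by. If the inequality failed at \<open>x0\<close>, it would fail on a
  neighbourhood; a member nearly reaching \<open>v\<close> near \<open>x0\<close> has its own
  maximum against the perturbed test function in that neighbourhood, where its subsolution property
  gives the contradiction.\<close>

lemma viscosity_subsolution_relaxed_sup:
  fixes \<Omega> :: "'a::euclidean_space set"
  assumes "open \<Omega>"
    and \<Phi>: "continuous_on (\<Omega> \<times> UNIV \<times> UNIV) (\<lambda>(x, r, p). \<Phi> x r p)"
    and v: "usc_on \<Omega> v"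
    and W: "\<And>w. w \<in> W \<Longrightarrow> viscosity_subsolution \<Omega> \<Phi> w"
    and le: "\<And>w x. w \<in> W \<Longrightarrow> x \<in> \<Omega> \<Longrightarrow> w x \<le> v x"
    and dense: "\<And>x c \<delta>. x \<in> \<Omega> \<Longrightarrow> c < v x \<Longrightarrow> \<delta> > 0 \<Longrightarrow> \<exists>y\<in>ball x \<delta> \<inter> \<Omega>. \<exists>w\<in>W. c < w y"
  shows "viscosity_subsolution \<Omega> \<Phi> v"
  unfolding viscosity_subsolution_def
proof (intro conjI allI impI v)
  fix \<phi> D x0
  assume C1: "C1_with_gradient \<Omega> \<phi> D" and "local_max_at \<Omega> (\<lambda>x. v x - \<phi> x) x0"
  then obtain r0 where x0: "x0 \<in> \<Omega>" and r0: "r0 > 0"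
    and max: "\<And>y. y \<in> ball x0 r0 \<inter> \<Omega> \<Longrightarrow> v y - \<phi> y \<le> v x0 - \<phi> x0"
    unfolding local_max_at_def by blast
  have "open (ball x0 r0 \<inter> \<Omega>)" "x0 \<in> ball x0 r0 \<inter> \<Omega>" using \<open>open \<Omega>\<close> x0 r0 by auto
  then obtain r where r: "r > 0" "cball x0 r \<subseteq> ball x0 r0 \<inter> \<Omega>"
    unfolding open_contains_cball by blast
  \<comment> \<open>Adding the paraboloid makes the maximum at \<open>x0\<close> strict, so maxima of \<open>w - f\<close> approach \<open>x0\<close>.\<close>
  define f where "f x = \<phi> x + (0 + 1 * (norm (x - x0))\<^sup>2)" for x
  define G where "G x = D x + (2 * 1) *\<^sub>R (x - x0)" for x
  have f: "C1_with_gradient \<Omega> f G"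
    unfolding f_def[abs_def] G_def[abs_def] by (rule C1_with_gradient_add_paraboloid[OF C1])
  have f_eq: "f x = \<phi> x + (dist x x0)\<^sup>2" for x by (simp add: f_def dist_norm)
  have fc: "continuous_on \<Omega> f" using f by (rule C1_with_gradient_imp_continuous_on)
  have Gc: "continuous_on \<Omega> G" using f by (simp add: C1_with_gradient_def)
  show "\<Phi> x0 (v x0) (D x0) \<le> 0"
  proof (rule ccontr)
    assume "\<not> ?thesis"
    then have "0 < \<Phi> x0 (v x0) (G x0)" by (simp add: G_def)
    then obtain e where e: "e > 0"
      "\<And>z s. z \<in> \<Omega> \<Longrightarrow> dist z x0 < e \<Longrightarrow> \<bar>s - v x0\<bar> < e \<Longrightarrow> 0 < \<Phi> z s (G z)"
      using positive_near_of_continuous_on[OF \<Phi> Gc x0] by metis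
    obtain d where d: "d > 0" "\<And>y. y \<in> \<Omega> \<Longrightarrow> dist y x0 < d \<Longrightarrow> \<bar>f y - f x0\<bar> < e / 2"
      using continuous_at_ball_bound[OF fc x0, of "e / 2"] e(1) by auto
    \<comment> \<open>The maximum point \<open>z\<close> found below has to lie within
      \<open>m\<close> of \<open>x0\<close>: inside the ball of radius \<open>r\<close>, where
      \<open>\<Phi>\<close> stays positive, and where \<open>f\<close> varies by less than
      \<open>e / 2\<close>. The tolerance \<open>\<eta>\<close> forces this through
      \<open>\<eta> \<le> m\<^sup>2\<close>, and \<open>\<eta> \<le> e / 2\<close> keeps
      \<open>w z\<close> near \<open>v x0\<close>.\<close>
    define m where "m = min r (min e d)"
    have m: "m > 0" "m \<le> r" "m \<le> e" "m \<le> d" using r e d by (auto simp: m_def)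
    define \<eta> where "\<eta> = min (m\<^sup>2) (e / 2)"
    have \<eta>: "\<eta> > 0" "\<eta> \<le> m\<^sup>2" "\<eta> \<le> e / 2" using m e by (auto simp: \<eta>_def)
    obtain d' where d': "d' > 0" "\<And>y. y \<in> \<Omega> \<Longrightarrow> dist y x0 < d' \<Longrightarrow> \<bar>f y - f x0\<bar> < \<eta> / 2"
      using continuous_at_ball_bound[OF fc x0, of "\<eta> / 2"] \<eta>(1) by auto
    obtain y w where y: "y \<in> ball x0 (min d' r) \<inter> \<Omega>" and w: "w \<in> W" "v x0 - \<eta> / 2 < w y"
      using dense[OF x0, of "v x0 - \<eta> / 2" "min d' r"] \<eta> d' r by auto
    have "\<bar>f y - f x0\<bar> < \<eta> / 2" using d'(2)[of y] y by (auto simp: dist_commute)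
    then have wy: "v x0 - f x0 - \<eta> < w y - f y" using w(2) by linarith
    have sub: "viscosity_subsolution \<Omega> \<Phi> w" using W w(1) .
    have "usc_on \<Omega> (\<lambda>x. w x - f x)"
      using sub fc by (intro usc_on_diff_continuous) (auto simp: viscosity_subsolution_def)
    then obtain z where z: "z \<in> cball x0 r" "\<And>x. x \<in> cball x0 r \<Longrightarrow> w x - f x \<le> w z - f z"
      using usc_on_attains_max[of \<Omega> "\<lambda>x. w x - f x" "cball x0 r"] r by auto
    have z\<Omega>: "z \<in> \<Omega>" using z(1) r by auto
    have "w y - f y \<le> w z - f z" using z(2)[of y] y by auto
    with wy have lb: "v x0 - f x0 - \<eta> < w z - f z" by linarith
    have "w z - \<phi> z \<le> v x0 - \<phi> x0"
      using le[OF w(1) z\<Omega>] max[of z] z(1) r(2) by fastforce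
    then have ub: "w z - f z \<le> v x0 - f x0 - (dist z x0)\<^sup>2" by (simp add: f_eq)
    \<comment> \<open>The value \<open>w z - f z\<close> falls short of \<open>v x0 - f x0\<close>
      by less than \<open>\<eta>\<close>, but by at least the squared distance.\<close>
    have "(dist z x0)\<^sup>2 < m\<^sup>2" using lb ub \<eta> by linarith
    then have zm: "dist z x0 < m" using m(1) by (simp add: power2_less_imp_less)
    have "local_max_at \<Omega> (\<lambda>x. w x - f x) z"
      unfolding local_max_at_def
    proof (intro conjI exI[of _ "r - dist z x0"] ballI z\<Omega>)
      show "r - dist z x0 > 0" using zm m by simp
      show "w x - f x \<le> w z - f z" if "x \<in> ball z (r - dist z x0) \<inter> \<Omega>" for x
      proof (rule z(2))
        show "x \<in> cball x0 r"
          using that dist_triangle[of x0 x z] by (simp add: dist_commute)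
      qed
    qed
    then have "\<Phi> z (w z) (G z) \<le> 0" using sub f unfolding viscosity_subsolution_def by blast
    moreover have "\<bar>f z - f x0\<bar> < e / 2" using d(2)[OF z\<Omega>] zm m by simp
    then have "\<bar>w z - v x0\<bar> < e"
      using lb ub \<eta>(3) zero_le_power2[of "dist z x0"] by linarith
    then have "0 < \<Phi> z (w z) (G z)" using e(2)[OF z\<Omega>] zm m by simp
    ultimately show False by simp
  qed
qed

text \<open>Where the supersolution inequality fails, the test function, bent down and slightly
  lifted, is a strict classical subsolution near \<open>x0\<close>. Taking the maximum with it on a
  small ball preserves the subsolution property, and \<open>less\<close> leaves room to stay below
  \<open>h\<close>.\<close>

lemma bump_above_non_supersolution:
  fixes \<Omega> :: "'a::euclidean_space set"
  assumes "open \<Omega>"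
    and \<Phi>: "continuous_on (\<Omega> \<times> UNIV \<times> UNIV) (\<lambda>(x, r, p). \<Phi> x r p)"
    and H: "H_continuous_on \<Omega> u" "H_continuous_on \<Omega> h" "interval_fun_le \<Omega> u h"
    and sub: "viscosity_subsolution \<Omega> \<Phi> (\<lambda>x. upper (u x))"
    and C1: "C1_with_gradient \<Omega> \<phi> D"
    and min: "local_min_at \<Omega> (\<lambda>x. lower (u x) - \<phi> x) x0"
    and neg: "\<Phi> x0 (lower (u x0)) (D x0) < 0"
    and less: "lower (u x0) < lower (h x0)"
  obtains u' where "H_continuous_on \<Omega> u'" "viscosity_subsolution \<Omega> \<Phi> (\<lambda>x. upper (u' x))"
    "interval_fun_le \<Omega> u u'" "interval_fun_le \<Omega> u' h" "lower (u x0) < lower (u' x0)"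
proof -
  define l where "l x = lower (u x)" for x
  define v where "v x = upper (u x)" for x
  have lv: "l x \<le> v x" for x by (simp add: l_def v_def)
  have lsc: "lsc_on \<Omega> l" and usc: "usc_on \<Omega> v"
    using H(1) unfolding H_continuous_on_iff l_def[abs_def] v_def[abs_def] by auto
  have lh: "lsc_on \<Omega> (\<lambda>x. lower (h x))" using H(2) by (simp add: H_continuous_on_iff)
  obtain R1 where x0: "x0 \<in> \<Omega>" and R1: "R1 > 0"
    "\<And>y. y \<in> ball x0 R1 \<inter> \<Omega> \<Longrightarrow> l x0 - \<phi> x0 \<le> l y - \<phi> y"
    using min unfolding local_min_at_def l_def by blast
  obtain R2 where R2: "R2 > 0" "ball x0 R2 \<subseteq> \<Omega>" using \<open>open \<Omega>\<close> x0 openE by blast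
  \<comment> \<open>The paraboloid keeps the bump \<open>b = f + t\<^sup>2\<close> below \<open>l\<close> at distance at least \<open>t\<close> from \<open>x0\<close>.\<close>
  define f where "f x = \<phi> x + ((l x0 - \<phi> x0) + (-1) * (norm (x - x0))\<^sup>2)" for x
  define G where "G x = D x + (2 * (-1)) *\<^sub>R (x - x0)" for x
  have f: "C1_with_gradient \<Omega> f G"
    unfolding f_def[abs_def] G_def[abs_def] by (rule C1_with_gradient_add_paraboloid[OF C1])
  have f_eq: "f x = \<phi> x + (l x0 - \<phi> x0) - (dist x x0)\<^sup>2" for x by (simp add: f_def dist_norm)
  have fx0: "f x0 = l x0" by (simp add: f_eq)
  have fc: "continuous_on \<Omega> f" using f by (rule C1_with_gradient_imp_continuous_on)
  have Gc: "continuous_on \<Omega> G" using f by (simp add: C1_with_gradient_def)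
  have "continuous_on (\<Omega> \<times> UNIV \<times> UNIV) (\<lambda>(x, r, p). - \<Phi> x r p)"
    using continuous_on_minus[OF \<Phi>] by (simp add: case_prod_unfold)
  moreover have "0 < - \<Phi> x0 (l x0) (G x0)" using neg by (simp add: G_def l_def)
  ultimately obtain e where e: "e > 0"
    "\<And>z s. z \<in> \<Omega> \<Longrightarrow> dist z x0 < e \<Longrightarrow> \<bar>s - l x0\<bar> < e \<Longrightarrow> 0 < - \<Phi> z s (G z)"
    using positive_near_of_continuous_on[OF _ Gc x0, of "\<lambda>x r p. - \<Phi> x r p"] by metis
  \<comment> \<open>The midpoint is a ceiling for the bump: by lower semicontinuity
    \<open>lower h\<close> stays above it near \<open>x0\<close>.\<close>
  define m where "m = (l x0 + lower (h x0)) / 2"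
  have m: "l x0 < m" "m < lower (h x0)" using less by (auto simp: m_def l_def)
  obtain d1 where d1: "d1 > 0" "\<And>y. y \<in> ball x0 d1 \<inter> \<Omega> \<Longrightarrow> m < lower (h y)"
    using lh x0 m(2) unfolding lsc_on_iff_ball by blast
  \<comment> \<open>The bump may leave \<open>l x0\<close> by up to \<open>2 * \<kappa>\<close>: one
    share for the variation of \<open>f\<close>, one for the lift \<open>t\<^sup>2\<close>. This
    stays within the range \<open>e\<close> of strict negativity and below the ceiling
    \<open>m\<close>.\<close>
  define \<kappa> where "\<kappa> = min e (m - l x0) / 2"
  have \<kappa>: "\<kappa> > 0" "2 * \<kappa> \<le> e" "2 * \<kappa> \<le> m - l x0" using e m by (auto simp: \<kappa>_def)
  obtain d2 where d2: "d2 > 0" "\<And>y. y \<in> \<Omega> \<Longrightarrow> dist y x0 < d2 \<Longrightarrow> \<bar>f y - l x0\<bar> < \<kappa>"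
    using continuous_at_ball_bound[OF fc x0 \<kappa>(1)] fx0 by metis
  define R where "R = min R1 R2"
  have R: "R > 0" using R1 R2 by (simp add: R_def)
  \<comment> \<open>The entry \<open>R / 2\<close> leaves a collar between radius \<open>t\<close>
    and \<open>R\<close> on which \<open>b \<le> l\<close>; \<open>sqrt \<kappa>\<close> limits the
    lift.\<close>
  define t where "t = Min {R / 2, e, d1, d2, sqrt \<kappa>}"
  have t: "t > 0" "2 * t \<le> R" "t \<le> e" "t \<le> d1" "t \<le> d2" "t \<le> sqrt \<kappa>"
    using R e d1 d2 \<kappa> by (auto simp: t_def)
  have t2: "t\<^sup>2 \<le> \<kappa>"
    using power_mono[OF t(6), of 2] t(1) \<kappa>(1) by simp
  define b where "b x = f x + t\<^sup>2" for x
  have bc: "continuous_on \<Omega> b" unfolding b_def[abs_def] by (intro continuous_intros fc)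
  have b_C1: "GDERIV b x :> G x" if "x \<in> \<Omega>" for x
    using GDERIV_add[OF _ GDERIV_const, of f x "G x" "t\<^sup>2"] f that
    unfolding b_def[abs_def] C1_with_gradient_def by simp
  have b_near: "\<bar>b y - l x0\<bar> < 2 * \<kappa>" if "y \<in> \<Omega>" "dist y x0 < t" for y
  proof -
    have "\<bar>f y - l x0\<bar> < \<kappa>" using d2(2)[OF that(1)] that(2) t by simp
    then show ?thesis using t2 zero_le_power2[of t] unfolding b_def by linarith
  qed
  have b_far: "b y \<le> l y" if "y \<in> \<Omega>" "dist y x0 < R" "t \<le> dist y x0" for y
  proof -
    have "t\<^sup>2 \<le> (dist y x0)\<^sup>2" using that(3) t(1) by (simp add: power_mono)
    moreover have "l x0 - \<phi> x0 \<le> l y - \<phi> y"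
      using R1(2)[of y] that by (simp add: R_def dist_commute)
    ultimately show ?thesis by (simp add: b_def f_eq)
  qed
  \<comment> \<open>Both endpoints are raised by the same bump. Lower semicontinuity of
    \<open>p\<close> survives because the raising happens on an open ball; upper semicontinuity of
    \<open>w\<close> needs the collar, where \<open>b \<le> l \<le> v\<close> makes the switch at
    radius \<open>t\<close> harmless. Beyond \<open>R\<close>, points closer than \<open>t\<close>
    never meet the bump.\<close>
  define p where "p x = (if dist x x0 < t then max (l x) (b x) else l x)" for x
  define w where "w x = (if dist x x0 < t then max (v x) (b x) else v x)" for x
  have lp: "l x \<le> p x" and vw: "v x \<le> w x" and pw: "p x \<le> w x" for x
    using lv[of x] by (auto simp: p_def w_def)
  have p_lsc: "lsc_on \<Omega> p"
    unfolding lsc_on_iff_ball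
  proof (intro ballI allI impI)
    fix x c assume x: "x \<in> \<Omega>" and c: "c < p x"
    show "\<exists>\<delta>>0. \<forall>y\<in>ball x \<delta> \<inter> \<Omega>. c < p y"
    proof (cases "c < l x")
      case True
      then obtain \<delta> where "\<delta> > 0" "\<forall>y\<in>ball x \<delta> \<inter> \<Omega>. c < l y"
        using lsc x unfolding lsc_on_iff_ball by blast
      then show ?thesis using lp less_le_trans by blast
    next
      case False
      then have xt: "dist x x0 < t" and cb: "c < b x"
        using c by (auto simp: p_def max_def split: if_splits)
      obtain \<delta> where \<delta>: "\<delta> > 0" "\<And>y. y \<in> \<Omega> \<Longrightarrow> dist y x < \<delta> \<Longrightarrow> \<bar>b y - b x\<bar> < b x - c"
        using continuous_at_ball_bound[OF bc x, of "b x - c"] cb by auto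
      show ?thesis
      proof (intro exI[of _ "min \<delta> (t - dist x x0)"] conjI ballI)
        show "min \<delta> (t - dist x x0) > 0" using \<delta> xt by simp
        fix y assume y: "y \<in> ball x (min \<delta> (t - dist x x0)) \<inter> \<Omega>"
        have "dist y x0 < t" using y dist_triangle[of y x0 x] by (simp add: dist_commute)
        moreover have "c < b y" using \<delta>(2)[of y] y by (simp add: dist_commute abs_less_iff)
        ultimately show "c < p y" by (simp add: p_def)
      qed
    qed
  qed
  have w_usc: "usc_on \<Omega> w"
    unfolding usc_on_iff_ball
  proof (intro ballI allI impI)
    fix x c assume x: "x \<in> \<Omega>" and c: "w x < c"
    have "v x < c" using vw[of x] c by simp
    then obtain \<delta> where \<delta>: "\<delta> > 0" "\<And>y. y \<in> ball x \<delta> \<inter> \<Omega> \<Longrightarrow> v y < c"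
      using usc x unfolding usc_on_iff_ball by blast
    show "\<exists>\<delta>>0. \<forall>y\<in>ball x \<delta> \<inter> \<Omega>. w y < c"
    proof (cases "dist x x0 < R")
      case True
      have "b x < c"
      proof (cases "dist x x0 < t")
        case True
        then show ?thesis using c by (simp add: w_def)
      next
        case False
        then show ?thesis using b_far[OF x True] lv[of x] \<open>v x < c\<close> by simp
      qed
      then obtain \<delta>' where \<delta>': "\<delta>' > 0" "\<And>y. y \<in> \<Omega> \<Longrightarrow> dist y x < \<delta>' \<Longrightarrow> \<bar>b y - b x\<bar> < c - b x"
        using continuous_at_ball_bound[OF bc x, of "c - b x"] by auto
      show ?thesis
      proof (intro exI[of _ "min \<delta> \<delta>'"] conjI ballI)
        fix y assume y: "y \<in> ball x (min \<delta> \<delta>') \<inter> \<Omega>"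
        have "b y < c" using \<delta>'(2)[of y] y by (simp add: dist_commute abs_less_iff)
        moreover have "v y < c" using \<delta>(2)[of y] y by simp
        ultimately show "w y < c" by (simp add: w_def)
      qed (use \<delta> \<delta>' in simp)
    next
      case False
      show ?thesis
      proof (intro exI[of _ "min \<delta> t"] conjI ballI)
        fix y assume y: "y \<in> ball x (min \<delta> t) \<inter> \<Omega>"
        have "\<not> dist y x0 < t" using y False t(2) dist_triangle[of x x0 y] by simp
        then show "w y < c" using \<delta>(2)[of y] y by (simp add: w_def)
      qed (use \<delta> t in simp)
    qed
  qed
  obtain u' where u': "H_continuous_on \<Omega> u'" "\<And>x. x \<in> \<Omega> \<Longrightarrow> p x \<le> lower (u' x)"
    "\<And>x c \<delta>. x \<in> \<Omega> \<Longrightarrow> c < upper (u' x) \<Longrightarrow> \<delta> > 0 \<Longrightarrow> \<exists>y\<in>ball x \<delta> \<inter> \<Omega>. c < p y"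
    using H_continuous_on_above_lsc[OF p_lsc w_usc pw] by metis
  have uu': "interval_fun_le \<Omega> u u'"
  proof (rule interval_fun_le_of_lower_le_upper[OF H(1) u'(1)])
    show "lower (u x) \<le> upper (u' x)" if "x \<in> \<Omega>" for x
      using lp[of x] u'(2)[OF that] lower_le_upper[of "u' x"] unfolding l_def by linarith
  qed
  have ph: "p x \<le> upper (h x)" if "x \<in> \<Omega>" for x
  proof -
    have "l x \<le> lower (h x)" using H(3) that by (simp add: interval_fun_le_def l_def)
    moreover have "b x \<le> lower (h x)" if "dist x x0 < t"
      using b_near[OF \<open>x \<in> \<Omega>\<close> that] d1(2)[of x] that \<open>x \<in> \<Omega>\<close> t \<kappa> by (simp add: dist_commute abs_less_iff)
    ultimately have "p x \<le> lower (h x)" by (simp add: p_def)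
    then show ?thesis using lower_le_upper[of "h x"] by linarith
  qed
  have u'h: "interval_fun_le \<Omega> u' h"
  proof (rule interval_fun_le_of_lower_le_upper[OF u'(1) H(2)])
    fix x assume x: "x \<in> \<Omega>"
    have "upper (u' x) \<le> upper (h x)"
      using H(2) ph x u'(3)[OF x] unfolding H_continuous_on_iff
      by (intro le_usc_on_of_le_dense[of \<Omega> "\<lambda>x. upper (h x)" p x "\<lambda>x. upper (u' x)"]) auto
    then show "lower (u' x) \<le> upper (h x)" using lower_le_upper[of "u' x"] by linarith
  qed
  \<comment> \<open>The H-continuous completion of \<open>p\<close> adds nothing beyond
    \<open>w\<close>: \<open>w\<close> is an upper semicontinuous majorant of \<open>p\<close>,
    while \<open>upper u'\<close> dominates both \<open>v\<close> and \<open>p\<close>, hence their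
    maximum \<open>w\<close>.\<close>
  have upper_u': "upper (u' x) = w x" if x: "x \<in> \<Omega>" for x
  proof (rule antisym)
    show "upper (u' x) \<le> w x"
      using w_usc pw x u'(3)[OF x] by (rule le_usc_on_of_le_dense)
    have "v x \<le> upper (u' x)" using uu' x by (simp add: interval_fun_le_def v_def)
    moreover have "p x \<le> upper (u' x)" using u'(2)[OF x] lower_le_upper[of "u' x"] by linarith
    ultimately show "w x \<le> upper (u' x)" by (auto simp: w_def p_def)
  qed
  have "viscosity_subsolution \<Omega> \<Phi> (\<lambda>x. upper (u' x))"
    unfolding viscosity_subsolution_def
  proof (intro conjI allI impI)
    show "usc_on \<Omega> (\<lambda>x. upper (u' x))" using u'(1) by (simp add: H_continuous_on_iff)
    fix \<theta> E x assume \<theta>: "C1_with_gradient \<Omega> \<theta> E" and "local_max_at \<Omega> (\<lambda>x. upper (u' x) - \<theta> x) x"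
    then obtain \<delta> where x: "x \<in> \<Omega>" and \<delta>: "\<delta> > 0"
      "\<And>y. y \<in> ball x \<delta> \<inter> \<Omega> \<Longrightarrow> w y - \<theta> y \<le> w x - \<theta> x"
      unfolding local_max_at_def using upper_u' by auto
    show "\<Phi> x (upper (u' x)) (E x) \<le> 0"
    \<comment> \<open>Where the bump is not felt, the maximum passes to \<open>v\<close> because
      \<open>v \<le> w\<close>. Elsewhere \<open>w x = b x\<close>, so \<open>b - \<theta>\<close>
      has a local maximum at \<open>x\<close>, the gradients agree, and strict negativity along
      \<open>b\<close> applies.\<close>
    proof (cases "w x = v x")
      case True
      have "local_max_at \<Omega> (\<lambda>x. v x - \<theta> x) x"
        unfolding local_max_at_def
      proof (intro conjI exI[of _ \<delta>] ballI x \<delta>(1))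
        show "v y - \<theta> y \<le> v x - \<theta> x" if "y \<in> ball x \<delta> \<inter> \<Omega>" for y
          using \<delta>(2)[OF that] vw[of y] True by linarith
      qed
      then have "\<Phi> x (v x) (E x) \<le> 0"
        using sub \<theta> unfolding viscosity_subsolution_def v_def by blast
      then show ?thesis using upper_u'[OF x] True by simp
    next
      case False
      then have xt: "dist x x0 < t" and wb: "w x = b x"
        by (auto simp: w_def max_def split: if_splits)
      have "open (ball x (min \<delta> (t - dist x x0)) \<inter> \<Omega>)" "x \<in> ball x (min \<delta> (t - dist x x0)) \<inter> \<Omega>"
        using \<open>open \<Omega>\<close> x \<delta> xt by auto
      then obtain r where r: "r > 0" "ball x r \<subseteq> ball x (min \<delta> (t - dist x x0)) \<inter> \<Omega>"
        using openE by blast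
      have "G x = E x"
      proof (rule GDERIV_eq_of_local_max[OF b_C1[OF x] _ r(1)])
        show "GDERIV \<theta> x :> E x" using \<theta> x by (simp add: C1_with_gradient_def)
        fix y assume "y \<in> ball x r"
        then have y: "y \<in> ball x (min \<delta> (t - dist x x0)) \<inter> \<Omega>" using r by blast
        then have "dist y x0 < t" using dist_triangle[of y x0 x] by (simp add: dist_commute)
        then have "b y \<le> w y" by (simp add: w_def)
        then show "b y - \<theta> y \<le> b x - \<theta> x" using \<delta>(2)[of y] y wb by simp
      qed
      moreover have "0 < - \<Phi> x (b x) (G x)"
        using e(2)[OF x, of "b x"] b_near[OF x xt] xt t \<kappa> by simp
      ultimately show ?thesis using upper_u'[OF x] wb by simp
    qed
  qed
  \<comment> \<open>The lift shows at the centre, where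
    \<open>b x0 = l x0 + t\<^sup>2\<close>.\<close>
  moreover have "l x0 < lower (u' x0)"
    using u'(2)[OF x0] t(1) fx0 by (simp add: p_def b_def) (smt (verit) zero_less_power)
  ultimately show thesis using that u'(1) uu' u'h unfolding l_def by blast
qed

theorem theorem15:
  fixes \<Omega> :: "(real ^ 'n) set"
    and \<Phi> :: "real ^ 'n \<Rightarrow> real \<Rightarrow> real ^ 'n \<Rightarrow> real"
    and u\<^sub>1 u\<^sub>2 :: "real ^ 'n \<Rightarrow> real interval"
  assumes "open \<Omega>"
    and "continuous_on (\<Omega> \<times> UNIV \<times> UNIV) (\<lambda>(x, r, p). \<Phi> x r p)"
    and "H_continuous_on \<Omega> u\<^sub>1" and "H_continuous_on \<Omega> u\<^sub>2"
    and "viscosity_subsolution \<Omega> \<Phi> (\<lambda>x. upper (u\<^sub>1 x))"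
    and "viscosity_supersolution \<Omega> \<Phi> (\<lambda>x. lower (u\<^sub>2 x))"
    and "interval_fun_le \<Omega> u\<^sub>1 u\<^sub>2"
  shows "\<exists>u. H_continuous_on \<Omega> u \<and> viscosity_solution \<Omega> \<Phi> u \<and>
             interval_fun_le \<Omega> u\<^sub>1 u \<and> interval_fun_le \<Omega> u u\<^sub>2"
proof -
  define U where "U = {w. H_continuous_on \<Omega> w \<and> viscosity_subsolution \<Omega> \<Phi> (\<lambda>x. upper (w x)) \<and>
    interval_fun_le \<Omega> u\<^sub>1 w \<and> interval_fun_le \<Omega> w u\<^sub>2}"
  \<comment> \<open>Lower endpoints are used because a supremum of lower semicontinuous functions is
    again lower semicontinuous. On \<open>\<Omega>\<close> the real supremum is genuine:
    \<open>u\<^sub>1\<close> lies in \<open>U\<close> and \<open>lower u\<^sub>2\<close> is a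
    bound.\<close>
  define p where "p x = (SUP w\<in>U. lower (w x))" for x
  have u\<^sub>1U: "u\<^sub>1 \<in> U" using assms by (simp add: U_def interval_fun_le_def)
  have Uu\<^sub>2: "lower (w x) \<le> lower (u\<^sub>2 x)" if "w \<in> U" "x \<in> \<Omega>" for w x
    using that by (simp add: U_def interval_fun_le_def)
  have bdd: "bdd_above ((\<lambda>w. lower (w x)) ` U)" if "x \<in> \<Omega>" for x
    using Uu\<^sub>2 that by (auto intro!: bdd_aboveI2)
  have Up: "lower (w x) \<le> p x" if "w \<in> U" "x \<in> \<Omega>" for w x
    unfolding p_def using that bdd by (intro cSUP_upper)
  have p_less: "\<exists>w\<in>U. c < lower (w x)" if "c < p x" "x \<in> \<Omega>" for c x
    using that bdd u\<^sub>1U unfolding p_def by (subst (asm) less_cSUP_iff) auto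
  have p_lsc: "lsc_on \<Omega> p"
    unfolding lsc_on_iff_ball
  proof (intro ballI allI impI)
    fix x c assume x: "x \<in> \<Omega>" and "c < p x"
    then obtain w where w: "w \<in> U" "c < lower (w x)" using p_less by blast
    then have "lsc_on \<Omega> (\<lambda>x. lower (w x))" by (simp add: U_def H_continuous_on_iff)
    then obtain \<delta> where \<delta>: "\<delta> > 0" "\<And>y. y \<in> ball x \<delta> \<inter> \<Omega> \<Longrightarrow> c < lower (w y)"
      using x w(2) unfolding lsc_on_iff_ball by blast
    have "c < p y" if "y \<in> ball x \<delta> \<inter> \<Omega>" for y
      using \<delta>(2)[OF that] Up[OF w(1), of y] that by simp
    then show "\<exists>\<delta>>0. \<forall>y\<in>ball x \<delta> \<inter> \<Omega>. c < p y" using \<delta>(1) by blast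
  qed
  have u\<^sub>2_usc: "usc_on \<Omega> (\<lambda>x. upper (u\<^sub>2 x))" using assms(4) by (simp add: H_continuous_on_iff)
  have pu\<^sub>2: "p x \<le> upper (u\<^sub>2 x)" if "x \<in> \<Omega>" for x
    unfolding p_def
  proof (rule cSUP_least)
    show "lower (w x) \<le> upper (u\<^sub>2 x)" if "w \<in> U" for w
      using Uu\<^sub>2[OF that \<open>x \<in> \<Omega>\<close>] lower_le_upper[of "u\<^sub>2 x"] by linarith
  qed (use u\<^sub>1U in blast)
  obtain u where u: "H_continuous_on \<Omega> u" "\<And>x. x \<in> \<Omega> \<Longrightarrow> p x \<le> lower (u x)"
    "\<And>x c \<delta>. x \<in> \<Omega> \<Longrightarrow> c < upper (u x) \<Longrightarrow> \<delta> > 0 \<Longrightarrow> \<exists>y\<in>ball x \<delta> \<inter> \<Omega>. c < p y"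
    using H_continuous_on_above_lsc[OF p_lsc u\<^sub>2_usc pu\<^sub>2] by metis
  \<comment> \<open>This is the maximality of \<open>u\<close> that the bump will
    contradict.\<close>
  have Uu: "interval_fun_le \<Omega> w u" if "w \<in> U" for w
  proof (rule interval_fun_le_of_lower_le_upper)
    show "lower (w x) \<le> upper (u x)" if "x \<in> \<Omega>" for x
      using Up[OF \<open>w \<in> U\<close> that] u(2)[OF that] lower_le_upper[of "u x"] by linarith
  qed (use that u(1) in \<open>simp_all add: U_def\<close>)
  have uu\<^sub>2: "interval_fun_le \<Omega> u u\<^sub>2"
  proof (rule interval_fun_le_of_lower_le_upper[OF u(1) assms(4)])
    fix x assume x: "x \<in> \<Omega>"
    have "upper (u x) \<le> upper (u\<^sub>2 x)"
      using u\<^sub>2_usc pu\<^sub>2 x u(3)[OF x] by (rule le_usc_on_of_le_dense)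
    then show "lower (u x) \<le> upper (u\<^sub>2 x)" using lower_le_upper[of "u x"] by linarith
  qed
  \<comment> \<open>Values of \<open>p\<close> approximate \<open>upper u\<close>, and each is
    nearly reached by some \<open>lower w \<le> upper w\<close>; so \<open>upper u\<close> is a
    relaxed supremum of the subsolutions \<open>upper w\<close>.\<close>
  have sub: "viscosity_subsolution \<Omega> \<Phi> (\<lambda>x. upper (u x))"
  proof (rule viscosity_subsolution_relaxed_sup[OF assms(1,2), where W = "(\<lambda>w x. upper (w x)) ` U"])
    show "usc_on \<Omega> (\<lambda>x. upper (u x))" using u(1) by (simp add: H_continuous_on_iff)
    show "viscosity_subsolution \<Omega> \<Phi> w" if "w \<in> (\<lambda>w x. upper (w x)) ` U" for w
      using that by (auto simp: U_def)
    show "w x \<le> upper (u x)" if "w \<in> (\<lambda>w x. upper (w x)) ` U" "x \<in> \<Omega>" for w x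
      using that Uu by (auto simp: interval_fun_le_def)
    fix x c and \<delta> :: real assume "x \<in> \<Omega>" "c < upper (u x)" "\<delta> > 0"
    then obtain y where y: "y \<in> ball x \<delta> \<inter> \<Omega>" "c < p y" using u(3) by blast
    then obtain w where w: "w \<in> U" "c < lower (w y)" using p_less by blast
    then have "c < upper (w y)" using lower_le_upper[of "w y"] by linarith
    then show "\<exists>y\<in>ball x \<delta> \<inter> \<Omega>. \<exists>w\<in>(\<lambda>w x. upper (w x)) ` U. c < w y"
      using y(1) w(1) by (intro bexI[of _ y] bexI[of _ "\<lambda>x. upper (w x)"]) auto
  qed
  have "viscosity_supersolution \<Omega> \<Phi> (\<lambda>x. lower (u x))"
    unfolding viscosity_supersolution_def
  proof (intro conjI allI impI)
    show "lsc_on \<Omega> (\<lambda>x. lower (u x))" using u(1) by (simp add: H_continuous_on_iff)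
    fix \<phi> D x0
    assume C1: "C1_with_gradient \<Omega> \<phi> D" and min: "local_min_at \<Omega> (\<lambda>x. lower (u x) - \<phi> x) x0"
    have x0: "x0 \<in> \<Omega>" using min by (simp add: local_min_at_def)
    have le: "lower (u x) \<le> lower (u\<^sub>2 x)" if "x \<in> \<Omega>" for x
      using uu\<^sub>2 that by (simp add: interval_fun_le_def)
    show "0 \<le> \<Phi> x0 (lower (u x0)) (D x0)"
    \<comment> \<open>At a contact point the test function also touches
      \<open>lower u\<^sub>2\<close> from below, and the supersolution property of
      \<open>lower u\<^sub>2\<close> is inherited. Away from contact there is room for a bump, which
      would give a member of \<open>U\<close> not below \<open>u\<close>.\<close>
    proof (cases "lower (u x0) = lower (u\<^sub>2 x0)")
      case True
      obtain \<delta> where \<delta>: "\<delta> > 0"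
        "\<And>y. y \<in> ball x0 \<delta> \<inter> \<Omega> \<Longrightarrow> lower (u x0) - \<phi> x0 \<le> lower (u y) - \<phi> y"
        using min unfolding local_min_at_def by blast
      have "local_min_at \<Omega> (\<lambda>x. lower (u\<^sub>2 x) - \<phi> x) x0"
        unfolding local_min_at_def
      proof (intro conjI exI[of _ \<delta>] ballI x0 \<delta>(1))
        show "lower (u\<^sub>2 x0) - \<phi> x0 \<le> lower (u\<^sub>2 y) - \<phi> y" if "y \<in> ball x0 \<delta> \<inter> \<Omega>" for y
          using \<delta>(2)[OF that] le[of y] that True by simp
      qed
      then show ?thesis using assms(6) C1 True unfolding viscosity_supersolution_def by metis
    next
      case False
      then have less: "lower (u x0) < lower (u\<^sub>2 x0)" using le[OF x0] by simp
      show ?thesis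
      proof (rule ccontr)
        assume "\<not> ?thesis"
        then have neg: "\<Phi> x0 (lower (u x0)) (D x0) < 0" by simp
        obtain u' where u': "H_continuous_on \<Omega> u'"
          "viscosity_subsolution \<Omega> \<Phi> (\<lambda>x. upper (u' x))"
          "interval_fun_le \<Omega> u u'" "interval_fun_le \<Omega> u' u\<^sub>2" "lower (u x0) < lower (u' x0)"
          using bump_above_non_supersolution[OF assms(1,2) u(1) assms(4) uu\<^sub>2 sub C1 min neg less]
          by blast
        have "interval_fun_le \<Omega> u\<^sub>1 u'"
          using Uu[OF u\<^sub>1U] u'(3) unfolding interval_fun_le_def by (meson order_trans)
        then have "u' \<in> U" using u' by (simp add: U_def)
        then have "lower (u' x0) \<le> lower (u x0)" using Uu x0 by (simp add: interval_fun_le_def)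
        then show False using u'(5) by simp
      qed
    qed
  qed
  then have "viscosity_solution \<Omega> \<Phi> u"
    using sub H_continuous_on_imp_S_continuous_on[OF u(1)] by (simp add: viscosity_solution_def)
  then show ?thesis using u(1) Uu[OF u\<^sub>1U] uu\<^sub>2 by blast
qed

end
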